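(* Let $G$ be a countable left-orderable group, $H$ a subgroup of $G$, $x\in Z_G(H)$ an element of the centralizer of $H$ in $G$, and $P\in\mathrm{Cof}_x^H(G)$. Let $\widetilde{A_{P,x}}$ be a normalized dynamical realization of $P$ (an action of $G$ on $\mathbb{R}$ conjugate to the dynamical realization $A_P$ in which $x$ acts as $r\mapsto r+1$), and let $A_{P,x}:H\to\mathrm{Homeo}_+(S^1)$ be the associated circle action. Then $$\psi_x^H(P)=-\,eu(A_{P,x})\quad\text{in } H_b^2(H;\mathbb{Z}).$$
   Context: A left ordering of a group $G$ is a total order $<$ on $G$ such that $a<b$ implies $ca<cb$ for all $c\in G$. It is identified with its positive cone $P=\{g\in G: g>1\}$, and we write $<_P$ for the ordering with positive cone $P$. $\mathrm{LO}(G)$ is the set of left orderings of $G$. $\mathrm{Cof}_x^H(G)$ is the set of $P\in\mathrm{LO}(G)$ such that for each $a\in H$ there is an integer $N$ with $x^{-N}<_P a<_P x^N$. Since $x$ centralizes $H$, every $P$ restricted to the subgroup generated by $H$ and $x$ is invariant under right multiplication by $x$. For $P\in\mathrm{Cof}_x^H(G)$ define $\rho_{x,P}^H:H\to\mathbb{Z}$ by: $\rho_{x,P}^H(h)$ is the integer $N$ with $x^N\le_P h<_P x^{N+1}$ if $x>_P1$, and the integer $N$ with $x^{N+1}<_P h\le_P x^{N}$ if $x<_P1$. This map is a quasi morphism (a map $\phi$ with $|\phi(gg')-\phi(g)-\phi(g')|$ bounded). $H_b^2(H;\mathbb{Z})$ denotes the kernel of the comparison map from the usual second bounded cohomology of $H$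 with $\mathbb{Z}$ coefficients to $H^2(H;\mathbb{Z})$. $\psi_x^H(P)$ is the class of the bounded cocycle $d\rho_{x,P}^H$, where $d\phi(g,g')=\phi(g)-\phi(gg')+\phi(g')$. Dynamical realization of $P\in\mathrm{LO}(G)$ ($G$ countable): enumerate $G=\{g_0,g_1,\dots\}$ with $g_0=1$; set $t(g_0)=0$ and, for $i\ge1$, set $t(g_i)=\max_{j<i}t(g_j)+1$ if $g_i>_P g_j$ for all $j<i$, $t(g_i)=\min_{j<i}t(g_j)-1$ if $g_i<_P g_j$ for all $j<i$, and otherwise $t(g_i)=(t(g_m)+t(g_M))/2$, where $m,M<i$, $g_m<_P g_i<_P g_M$ and no $g_j$ with $j<i$ lies strictly between $g_m$ and $g_M$. The action $g\cdot t(g_i)=t(gg_i)$ of $G$ on $\{t(g_i)\}\subset\mathbb{R}$ is extended to an action $A_P:G\to\mathrm{Homeo}_+(\mathbb{R})$ (continuously to the closure of $\{t(g_i)\}$, and then affinely on the complementary intervals). Associated circle action: conjugate $A_P$ by a homeomorphism of $\mathbb{R}$ (orientation-reversing if $x<_P1$) so that $x$ acts as the translation $r\mapsto r+1$; the result is denoted $\widetilde{A_{P,x}}$. Since $x\in Z_G(H)$, $[\widetilde{A_{P,x}}(h)](r+1)=[\widetilde{A_{P,x}}(h)](r)+1$ for $h\in H$, $r\in\mathbb{R}$, so the restriction of $\widetilde{A_{P,x}}$ to $H$ induces an action $A_{P,x}:H\to\mathrm{Homeo}_+(S^1)$ on $S^1=\mathbb{R}/\mathbb{Z}$. Bounded Euler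 class: let $\widetilde{\mathrm{Homeo}_+}(S^1)=\{\tilde f\in\mathrm{Homeo}_+(\mathbb{R}):\tilde f(r+1)=\tilde f(r)+1\ \forall r\}$, with projection $p$ to $\mathrm{Homeo}_+(S^1)$, whose kernel is the group $\mathbb{Z}$ of integer translations. For $f\in\mathrm{Homeo}_+(S^1)$ let $\sigma(f)$ be the unique lift with $\sigma(f)(0)\in[0,1)$, and let $c(f,g)=\sigma(fg)^{-1}\sigma(f)\sigma(g)\in\mathbb{Z}$, a bounded $2$-cocycle with second bounded cohomology class $[eu]$. For an action $\phi:H\to\mathrm{Homeo}_+(S^1)$, $eu(\phi)=\phi^*([eu])$. *)

theory Defs
  imports "HOL-Analysis.Analysis" "HOL-Algebra.Coset"
begin

section \<open>Left orderings\<close>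

definition left_ordering :: "('a, 'b) monoid_scheme \<Rightarrow> ('a \<Rightarrow> 'a \<Rightarrow> bool) \<Rightarrow> bool" where
  "left_ordering G lt \<longleftrightarrow>
     (\<forall>a\<in>carrier G. \<not> lt a a) \<and>
     (\<forall>a\<in>carrier G. \<forall>b\<in>carrier G. \<forall>c\<in>carrier G. lt a b \<longrightarrow> lt b c \<longrightarrow> lt a c) \<and>
     (\<forall>a\<in>carrier G. \<forall>b\<in>carrier G. lt a b \<or> a = b \<or> lt b a) \<and>
     (\<forall>a\<in>carrier G. \<forall>b\<in>carrier G. \<forall>c\<in>carrier G.
        lt a b \<longrightarrow> lt (c \<otimes>\<^bsub>G\<^esub> a) (c \<otimes>\<^bsub>G\<^esub> b))"

definition LO :: "('a, 'b) monoid_scheme \<Rightarrow> 'a set set" where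
  "LO G = {P. \<exists>lt. left_ordering G lt \<and> P = {g \<in> carrier G. lt \<one>\<^bsub>G\<^esub> g}}"

text \<open>The ordering with positive cone \<open>P\<close>; see \<open>cone_less_eq\<close> below.\<close>

definition cone_less :: "('a, 'b) monoid_scheme \<Rightarrow> 'a set \<Rightarrow> 'a \<Rightarrow> 'a \<Rightarrow> bool" where
  "cone_less G P a b \<longleftrightarrow> inv\<^bsub>G\<^esub> a \<otimes>\<^bsub>G\<^esub> b \<in> P"

definition cone_le :: "('a, 'b) monoid_scheme \<Rightarrow> 'a set \<Rightarrow> 'a \<Rightarrow> 'a \<Rightarrow> bool" where
  "cone_le G P a b \<longleftrightarrow> cone_less G P a b \<or> a = b"

lemma cone_less_eq:
  assumes "group G" "left_ordering G lt" "P = {g \<in> carrier G. lt \<one>\<^bsub>G\<^esub> g}"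
    and a: "a \<in> carrier G" and b: "b \<in> carrier G"
  shows "cone_less G P a b \<longleftrightarrow> lt a b"
proof -
  interpret group G by fact
  have L: "lt (c \<otimes>\<^bsub>G\<^esub> u) (c \<otimes>\<^bsub>G\<^esub> v)"
    if "lt u v" "u \<in> carrier G" "v \<in> carrier G" "c \<in> carrier G" for u v c
    using assms(2) that unfolding left_ordering_def by blast
  have "lt \<one>\<^bsub>G\<^esub> (inv\<^bsub>G\<^esub> a \<otimes>\<^bsub>G\<^esub> b)" if "lt a b"
    using L[OF that a b, of "inv\<^bsub>G\<^esub> a"] a by simp
  moreover have "lt a b" if "lt \<one>\<^bsub>G\<^esub> (inv\<^bsub>G\<^esub> a \<otimes>\<^bsub>G\<^esub> b)"
    using L[OF that _ _ a] a b by (simp add: m_assoc[symmetric])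
  ultimately show ?thesis
    using a b unfolding cone_less_def assms(3) by auto
qed

definition centralizer :: "('a, 'b) monoid_scheme \<Rightarrow> 'a set \<Rightarrow> 'a set" where
  "centralizer G H = {x \<in> carrier G. \<forall>h\<in>H. x \<otimes>\<^bsub>G\<^esub> h = h \<otimes>\<^bsub>G\<^esub> x}"

definition Cof :: "('a, 'b) monoid_scheme \<Rightarrow> 'a set \<Rightarrow> 'a \<Rightarrow> 'a set set" where
  "Cof G H x = {P \<in> LO G. \<forall>a\<in>H. \<exists>N::int.
     cone_less G P (x [^]\<^bsub>G\<^esub> (- N)) a \<and> cone_less G P a (x [^]\<^bsub>G\<^esub> N)}"

definition rho :: "('a, 'b) monoid_scheme \<Rightarrow> 'a \<Rightarrow> 'a set \<Rightarrow> 'a \<Rightarrow> int" where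
  "rho G x P h =
     (if cone_less G P \<one>\<^bsub>G\<^esub> x
      then THE N::int. cone_le G P (x [^]\<^bsub>G\<^esub> N) h \<and> cone_less G P h (x [^]\<^bsub>G\<^esub> (N + 1))
      else THE N::int. cone_less G P (x [^]\<^bsub>G\<^esub> (N + 1)) h \<and> cone_le G P h (x [^]\<^bsub>G\<^esub> N))"

section \<open>Second (bounded) cohomology with integer coefficients\<close>

text \<open>
  Inhomogeneous cochains.  A 2-cochain on \<open>K\<close> is a function on pairs that vanishes outside
  \<open>carrier K \<times> carrier K\<close>, so that it is determined by its values on \<open>K\<close>.
\<close>

definition cob1 :: "('a, 'b) monoid_scheme \<Rightarrow> ('a \<Rightarrow> int) \<Rightarrow> 'a \<times> 'a \<Rightarrow> int" where
  "cob1 K \<phi> = (\<lambda>(g, h). if g \<in> carrier K \<and> h \<in> carrier K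
                         then \<phi> g - \<phi> (g \<otimes>\<^bsub>K\<^esub> h) + \<phi> h else 0)"

definition Z2 :: "('a, 'b) monoid_scheme \<Rightarrow> ('a \<times> 'a \<Rightarrow> int) monoid" where
  "Z2 K = \<lparr>carrier = {c. (\<forall>p. p \<notin> carrier K \<times> carrier K \<longrightarrow> c p = 0) \<and>
       (\<forall>g\<in>carrier K. \<forall>h\<in>carrier K. \<forall>k\<in>carrier K.
          c (h, k) - c (g \<otimes>\<^bsub>K\<^esub> h, k) + c (g, h \<otimes>\<^bsub>K\<^esub> k) - c (g, h) = 0)},
     monoid.mult = (\<lambda>c c' p. c p + c' p), one = (\<lambda>_. 0)\<rparr>"

definition B2 :: "('a, 'b) monoid_scheme \<Rightarrow> ('a \<times> 'a \<Rightarrow> int) set" where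
  "B2 K = range (cob1 K)"

definition Zb2 :: "('a, 'b) monoid_scheme \<Rightarrow> ('a \<times> 'a \<Rightarrow> int) monoid" where
  "Zb2 K = (Z2 K)\<lparr>carrier := {c \<in> carrier (Z2 K). \<exists>M. \<forall>p. \<bar>c p\<bar> \<le> M}\<rparr>"

definition Bb2 :: "('a, 'b) monoid_scheme \<Rightarrow> ('a \<times> 'a \<Rightarrow> int) set" where
  "Bb2 K = {cob1 K \<phi> |\<phi>. \<exists>M. \<forall>g\<in>carrier K. \<bar>\<phi> g\<bar> \<le> M}"

definition H2 :: "('a, 'b) monoid_scheme \<Rightarrow> ('a \<times> 'a \<Rightarrow> int) set monoid" where
  "H2 K = Z2 K Mod B2 K"

definition full_Hb2 :: "('a, 'b) monoid_scheme \<Rightarrow> ('a \<times> 'a \<Rightarrow> int) set monoid" where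
  "full_Hb2 K = Zb2 K Mod Bb2 K"

text \<open>
  Maps between cohomology groups induced by cochain maps are defined on a coset as the union of
  the cosets of the images of its members; these all coincide.
\<close>

definition comparison ::
    "('a, 'b) monoid_scheme \<Rightarrow> ('a \<times> 'a \<Rightarrow> int) set \<Rightarrow> ('a \<times> 'a \<Rightarrow> int) set" where
  "comparison K X = (\<Union>c\<in>X. B2 K #>\<^bsub>Z2 K\<^esub> c)"

definition Hb2 :: "('a, 'b) monoid_scheme \<Rightarrow> ('a \<times> 'a \<Rightarrow> int) set monoid" where
  "Hb2 K = (full_Hb2 K)\<lparr>carrier := kernel (full_Hb2 K) (H2 K) (comparison K)\<rparr>"

definition bclass ::
    "('a, 'b) monoid_scheme \<Rightarrow> ('a \<times> 'a \<Rightarrow> int) \<Rightarrow> ('a \<times> 'a \<Rightarrow> int) set" where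
  "bclass K c = Bb2 K #>\<^bsub>Zb2 K\<^esub> c"

definition pullback_cochain ::
    "('a, 'b) monoid_scheme \<Rightarrow> ('a \<Rightarrow> 'c) \<Rightarrow> ('c \<times> 'c \<Rightarrow> int) \<Rightarrow> 'a \<times> 'a \<Rightarrow> int" where
  "pullback_cochain K f c =
     (\<lambda>(g, h). if g \<in> carrier K \<and> h \<in> carrier K then c (f g, f h) else 0)"

definition pullback ::
    "('a, 'b) monoid_scheme \<Rightarrow> ('a \<Rightarrow> 'c) \<Rightarrow> ('c \<times> 'c \<Rightarrow> int) set \<Rightarrow> ('a \<times> 'a \<Rightarrow> int) set" where
  "pullback K f X = (\<Union>c\<in>X. bclass K (pullback_cochain K f c))"

definition psi ::
    "('a, 'b) monoid_scheme \<Rightarrow> 'a set \<Rightarrow> 'a \<Rightarrow> 'a set \<Rightarrow> ('a \<times> 'a \<Rightarrow> int) set" where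
  "psi G H x P = bclass (G\<lparr>carrier := H\<rparr>) (cob1 (G\<lparr>carrier := H\<rparr>) (rho G x P))"

section \<open>Homeomorphisms of the line and of the circle\<close>

definition Homeo_line :: "(real \<Rightarrow> real) monoid" where
  "Homeo_line = \<lparr>carrier = {f. (\<exists>g. homeomorphism UNIV UNIV f g) \<and> strict_mono f},
     monoid.mult = (\<circ>), one = id\<rparr>"

definition Homeo_tilde :: "(real \<Rightarrow> real) monoid" where
  "Homeo_tilde = Homeo_line
     \<lparr>carrier := {F \<in> carrier Homeo_line. \<forall>r. F (r + 1) = F r + 1}\<rparr>"

quotient_type circle = real / "\<lambda>r s :: real. r - s \<in> \<int>"
  morphisms rep_circle to_circle
proof (rule equivpI)
  show "reflp (\<lambda>r s :: real. r - s \<in> \<int>)"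
    by (simp add: reflp_def)
  show "symp (\<lambda>r s :: real. r - s \<in> \<int>)"
  proof (rule sympI)
    fix r s :: real
    assume "r - s \<in> \<int>"
    then have "- (r - s) \<in> \<int>" by (rule Ints_minus)
    then show "s - r \<in> \<int>" by simp
  qed
  show "transp (\<lambda>r s :: real. r - s \<in> \<int>)"
  proof (rule transpI)
    fix r s t :: real
    assume "r - s \<in> \<int>" "s - t \<in> \<int>"
    then have "(r - s) + (s - t) \<in> \<int>" by (rule Ints_add)
    then show "r - t \<in> \<int>" by simp
  qed
qed

instantiation circle :: topological_space
begin

definition open_circle :: "circle set \<Rightarrow> bool" where
  "open_circle U \<longleftrightarrow> open (to_circle -` U)"

instance
  by standard (auto simp: open_circle_def vimage_Union)

end

text \<open>
  A homeomorphism of the circle preserves orientation iff it lifts to an increasing homeomorphism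
  of the line, which then commutes with integer translations.
\<close>

definition Homeo_circle :: "(circle \<Rightarrow> circle) monoid" where
  "Homeo_circle = \<lparr>carrier = {f. (\<exists>g. homeomorphism UNIV UNIV f g) \<and>
       (\<exists>F\<in>carrier Homeo_tilde. \<forall>r. f (to_circle r) = to_circle (F r))},
     monoid.mult = (\<circ>), one = id\<rparr>"

definition circle_proj :: "(real \<Rightarrow> real) \<Rightarrow> circle \<Rightarrow> circle" where
  "circle_proj F = (THE f. \<forall>r. f (to_circle r) = to_circle (F r))"

section \<open>The bounded Euler class\<close>

definition sigma :: "(circle \<Rightarrow> circle) \<Rightarrow> real \<Rightarrow> real" where
  "sigma f = (THE F. F \<in> carrier Homeo_tilde \<and> circle_proj F = f \<and> F 0 \<in> {0..<1})"

definition euler_cocycle :: "(circle \<Rightarrow> circle) \<times> (circle \<Rightarrow> circle) \<Rightarrow> int" where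
  "euler_cocycle = (\<lambda>(f, g).
     if f \<in> carrier Homeo_circle \<and> g \<in> carrier Homeo_circle
     then THE n::int. inv\<^bsub>Homeo_tilde\<^esub> (sigma (f \<otimes>\<^bsub>Homeo_circle\<^esub> g))
            \<otimes>\<^bsub>Homeo_tilde\<^esub> sigma f \<otimes>\<^bsub>Homeo_tilde\<^esub> sigma g = (\<lambda>r. r + of_int n)
     else 0)"

definition eu :: "('a, 'b) monoid_scheme \<Rightarrow> ('a \<Rightarrow> circle \<Rightarrow> circle) \<Rightarrow> ('a \<times> 'a \<Rightarrow> int) set" where
  "eu K \<phi> = pullback K \<phi> (bclass Homeo_circle euler_cocycle)"

section \<open>Dynamical realizations\<close>

text \<open>
  \<open>e\<close> lists the group without repetitions.  A bijection with the naturals exists for every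
  nontrivial countable left-orderable group, since such a group is infinite.
\<close>

definition enumeration :: "('a, 'b) monoid_scheme \<Rightarrow> (nat \<Rightarrow> 'a) \<Rightarrow> bool" where
  "enumeration G e \<longleftrightarrow> bij_betw e UNIV (carrier G) \<and> e 0 = \<one>\<^bsub>G\<^esub>"

definition realization_points ::
    "('a, 'b) monoid_scheme \<Rightarrow> 'a set \<Rightarrow> (nat \<Rightarrow> 'a) \<Rightarrow> ('a \<Rightarrow> real) \<Rightarrow> bool" where
  "realization_points G P e t \<longleftrightarrow>
     t (e 0) = 0 \<and>
     (\<forall>i\<ge>1.
        if \<forall>j<i. cone_less G P (e j) (e i) then t (e i) = (MAX j\<in>{..<i}. t (e j)) + 1
        else if \<forall>j<i. cone_less G P (e i) (e j) then t (e i) = (MIN j\<in>{..<i}. t (e j)) - 1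
        else \<forall>m<i. \<forall>M<i. cone_less G P (e m) (e i) \<and> cone_less G P (e i) (e M) \<and>
               \<not> (\<exists>j<i. cone_less G P (e m) (e j) \<and> cone_less G P (e j) (e M)) \<longrightarrow>
               t (e i) = (t (e m) + t (e M)) / 2)"

text \<open>
  The values of \<open>A g\<close> on the closure of the orbit are forced by continuity; the last clause
  fixes them on the complementary intervals.
\<close>

definition dynamical_realization ::
    "('a, 'b) monoid_scheme \<Rightarrow> 'a set \<Rightarrow> (nat \<Rightarrow> 'a) \<Rightarrow> ('a \<Rightarrow> real \<Rightarrow> real) \<Rightarrow> bool" where
  "dynamical_realization G P e A \<longleftrightarrow>
     A \<in> hom G Homeo_line \<and>
     (\<exists>t. realization_points G P e t \<and>
        (\<forall>g\<in>carrier G. \<forall>h\<in>carrier G. A g (t h) = t (g \<otimes>\<^bsub>G\<^esub> h)) \<and>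
        (\<forall>g\<in>carrier G. \<forall>I\<in>components (- closure (t ` carrier G)).
           \<exists>a b. \<forall>r\<in>I. A g r = a * r + b))"

definition normalized_realization ::
    "('a, 'b) monoid_scheme \<Rightarrow> 'a \<Rightarrow> 'a set \<Rightarrow> ('a \<Rightarrow> real \<Rightarrow> real) \<Rightarrow> ('a \<Rightarrow> real \<Rightarrow> real) \<Rightarrow> bool" where
  "normalized_realization G x P A B \<longleftrightarrow>
     (\<exists>\<phi> \<phi>'. homeomorphism UNIV UNIV \<phi> \<phi>' \<and>
        (if cone_less G P \<one>\<^bsub>G\<^esub> x then strict_mono \<phi> else antimono \<phi>) \<and>
        (\<forall>g\<in>carrier G. B g = \<phi> \<circ> A g \<circ> \<phi>')) \<and>
     B x = (\<lambda>r. r + 1)"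

definition circle_action :: "('a \<Rightarrow> real \<Rightarrow> real) \<Rightarrow> 'a \<Rightarrow> circle \<Rightarrow> circle" where
  "circle_action B h = circle_proj (B h)"

end

theory Submission
  imports Defs
begin

text \<open>
  Both classes are coboundaries of explicit quasimorphisms.  Since \<open>x\<close> acts by \<open>r \<mapsto> r + 1\<close>, comparing
  \<open>h\<close> with the powers of \<open>x\<close> amounts to locating \<open>B h s\<close> among the points \<open>s + N\<close>, where \<open>s\<close> is the
  image of the base point of the realization; hence \<open>\<rho> h = \<lfloor>B h s - s\<rfloor>\<close>, for either sign of \<open>x\<close>.
  The canonical lift of the circle map of \<open>h\<close> is \<open>B h - \<lfloor>B h 0\<rfloor>\<close>, so the Euler cocycle pulls back
  to minus the coboundary of \<open>h \<mapsto> \<lfloor>B h 0\<rfloor>\<close>.  The two quasimorphisms differ by a bounded function,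
  because the displacement \<open>F r - r\<close> of a lift varies by less than \<open>1\<close>.
\<close>

section \<open>Bounded cohomology classes of coboundaries\<close>

lemma cob1_add: "cob1 K (\<lambda>h. \<phi> h + \<psi> h) p = cob1 K \<phi> p + cob1 K \<psi> p"
  by (cases p) (simp add: cob1_def)

lemma cob1_minus: "cob1 K (\<lambda>h. - \<phi> h) p = - cob1 K \<phi> p"
  by (cases p) (simp add: cob1_def)

lemma cob1_zero: "cob1 K (\<lambda>_. 0) p = 0"
  by (cases p) (simp add: cob1_def)

lemma cob1_in_Z2:
  assumes "group K"
  shows "cob1 K \<phi> \<in> carrier (Z2 K)"
proof -
  interpret group K by fact
  show ?thesis
    by (auto simp: Z2_def cob1_def m_assoc)
qed

lemma cob1_bounded:
  assumes "group K" and M: "\<forall>g\<in>carrier K. \<bar>\<phi> g\<bar> \<le> M"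
  shows "\<exists>M'. \<forall>p. \<bar>cob1 K \<phi> p\<bar> \<le> M'"
proof -
  interpret group K by fact
  have "\<bar>cob1 K \<phi> p\<bar> \<le> 3 * \<bar>M\<bar>" for p
  proof (cases "p \<in> carrier K \<times> carrier K")
    case True
    then obtain g h where p: "p = (g, h)" "g \<in> carrier K" "h \<in> carrier K" by auto
    then have "\<bar>\<phi> g\<bar> \<le> M" "\<bar>\<phi> h\<bar> \<le> M" "\<bar>\<phi> (g \<otimes>\<^bsub>K\<^esub> h)\<bar> \<le> M"
      using M by auto
    then show ?thesis
      using p by (simp add: cob1_def)
  qed (cases p; auto simp: cob1_def)
  then show ?thesis by blast
qed

lemma cob1_in_Zb2:
  assumes "group K" "\<exists>M. \<forall>p. \<bar>cob1 K \<phi> p\<bar> \<le> M"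
  shows "cob1 K \<phi> \<in> carrier (Zb2 K)"
  using assms cob1_in_Z2 by (auto simp: Zb2_def)

lemma mult_Zb2: "c \<otimes>\<^bsub>Zb2 K\<^esub> c' = (\<lambda>p. c p + c' p)"
  and one_Zb2: "\<one>\<^bsub>Zb2 K\<^esub> = (\<lambda>_. 0)"
  and mult_Z2: "c \<otimes>\<^bsub>Z2 K\<^esub> c' = (\<lambda>p. c p + c' p)"
  by (auto simp: Zb2_def Z2_def)

section \<open>The quotient of bounded cocycles by bounded coboundaries\<close>

lemma comm_group_Zb2: "comm_group (Zb2 K)"
proof (rule comm_groupI)
  fix c c' assume c: "c \<in> carrier (Zb2 K)" and c': "c' \<in> carrier (Zb2 K)"
  obtain M M' where "\<forall>p. \<bar>c p\<bar> \<le> M" "\<forall>p. \<bar>c' p\<bar> \<le> M'"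
    using c c' by (auto simp: Zb2_def)
  then have "\<forall>p. \<bar>c p + c' p\<bar> \<le> M + M'"
    by (meson abs_triangle_ineq add_mono order_trans)
  moreover have "(\<lambda>p. c p + c' p) \<in> carrier (Z2 K)"
    using c c' by (simp add: Zb2_def Z2_def algebra_simps)
  ultimately show "c \<otimes>\<^bsub>Zb2 K\<^esub> c' \<in> carrier (Zb2 K)"
    unfolding mult_Zb2 by (auto simp: Zb2_def)
next
  fix c assume c: "c \<in> carrier (Zb2 K)"
  have "(\<lambda>p. - c p) \<in> carrier (Zb2 K)"
    using c by (simp add: Zb2_def Z2_def algebra_simps)
  then show "\<exists>y\<in>carrier (Zb2 K). y \<otimes>\<^bsub>Zb2 K\<^esub> c = \<one>\<^bsub>Zb2 K\<^esub>"
    by (rule rev_bexI) (simp add: mult_Zb2 one_Zb2)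
next
  show "\<one>\<^bsub>Zb2 K\<^esub> \<in> carrier (Zb2 K)"
    unfolding one_Zb2 by (auto simp: Zb2_def Z2_def)
qed (simp_all add: mult_Zb2 one_Zb2 add_ac)

lemma subgroup_Bb2:
  assumes "group K"
  shows "subgroup (Bb2 K) (Zb2 K)"
proof -
  interpret Z: comm_group "Zb2 K" by (rule comm_group_Zb2)
  show ?thesis
  proof (rule Z.subgroupI)
    show "Bb2 K \<subseteq> carrier (Zb2 K)"
      using assms cob1_bounded cob1_in_Zb2 by (fastforce simp: Bb2_def)
  next
    have "cob1 K (\<lambda>_. 0) \<in> Bb2 K"
      by (auto simp: Bb2_def)
    then show "Bb2 K \<noteq> {}" by blast
  next
    fix c assume c: "c \<in> Bb2 K"
    then obtain \<phi> M where \<phi>: "c = cob1 K \<phi>" "\<forall>g\<in>carrier K. \<bar>\<phi> g\<bar> \<le> M"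
      by (auto simp: Bb2_def)
    have "cob1 K (\<lambda>h. - \<phi> h) \<in> Bb2 K"
      unfolding Bb2_def using \<phi>(2) by (intro CollectI exI[of _ "\<lambda>h. - \<phi> h"]) auto
    moreover have "c \<in> carrier (Zb2 K)" "cob1 K (\<lambda>h. - \<phi> h) \<in> carrier (Zb2 K)"
      using cob1_bounded[OF assms, of \<phi>] cob1_bounded[OF assms, of "\<lambda>h. - \<phi> h"] \<phi>
        cob1_in_Zb2[OF assms] by auto
    moreover have "cob1 K (\<lambda>h. - \<phi> h) \<otimes>\<^bsub>Zb2 K\<^esub> c = \<one>\<^bsub>Zb2 K\<^esub>"
      by (simp add: mult_Zb2 one_Zb2 cob1_minus \<phi>(1))
    ultimately show "inv\<^bsub>Zb2 K\<^esub> c \<in> Bb2 K"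
      using Z.inv_equality by metis
  next
    fix c c' assume "c \<in> Bb2 K" "c' \<in> Bb2 K"
    then obtain \<phi> M \<psi> M' where \<phi>: "c = cob1 K \<phi>" "\<forall>g\<in>carrier K. \<bar>\<phi> g\<bar> \<le> M"
      and \<psi>: "c' = cob1 K \<psi>" "\<forall>g\<in>carrier K. \<bar>\<psi> g\<bar> \<le> M'"
      by (auto simp: Bb2_def)
    have "\<forall>g\<in>carrier K. \<bar>\<phi> g + \<psi> g\<bar> \<le> M + M'"
      using \<phi>(2) \<psi>(2) by (meson abs_triangle_ineq add_mono order_trans)
    then have "cob1 K (\<lambda>h. \<phi> h + \<psi> h) \<in> Bb2 K"
      unfolding Bb2_def by blast
    moreover have "c \<otimes>\<^bsub>Zb2 K\<^esub> c' = cob1 K (\<lambda>h. \<phi> h + \<psi> h)"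
      by (simp add: mult_Zb2 \<phi>(1) \<psi>(1) cob1_add fun_eq_iff)
    ultimately show "c \<otimes>\<^bsub>Zb2 K\<^esub> c' \<in> Bb2 K" by simp
  qed
qed

lemma normal_Bb2:
  assumes "group K"
  shows "normal (Bb2 K) (Zb2 K)"
  using comm_group.normal_iff_subgroup[OF comm_group_Zb2] subgroup_Bb2[OF assms] by blast

text \<open>A bounded change of \<open>\<phi>\<close> moves its coboundary by an element of
  \<open>Bb2 K\<close>, so the coset stays the same. This lets one quasimorphism be replaced by
  another at bounded distance.\<close>

lemma bclass_cong:
  assumes "group K" "\<exists>M. \<forall>p. \<bar>cob1 K \<phi> p\<bar> \<le> M"
    and M: "\<forall>h\<in>carrier K. \<bar>\<phi> h - \<psi> h\<bar> \<le> M"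
  shows "bclass K (cob1 K \<psi>) = bclass K (cob1 K \<phi>)"
proof -
  interpret Z: comm_group "Zb2 K" by (rule comm_group_Zb2)
  have "\<forall>h\<in>carrier K. \<bar>\<psi> h - \<phi> h\<bar> \<le> M"
    using M by (simp add: abs_minus_commute)
  then have "cob1 K (\<lambda>h. \<psi> h - \<phi> h) \<in> Bb2 K"
    unfolding Bb2_def by blast
  moreover have "cob1 K \<psi> = cob1 K (\<lambda>h. \<psi> h - \<phi> h) \<otimes>\<^bsub>Zb2 K\<^esub> cob1 K \<phi>"
    by (simp add: mult_Zb2 cob1_add[symmetric])
  ultimately have "cob1 K \<psi> \<in> bclass K (cob1 K \<phi>)"
    unfolding bclass_def r_coset_def by blast
  then show ?thesis
    using Z.repr_independence[of "cob1 K \<psi>" "Bb2 K" "cob1 K \<phi>"] subgroup_Bb2[OF assms(1)]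
      cob1_in_Zb2[OF assms(1,2)] by (simp add: bclass_def)
qed

text \<open>\<open>B2 K\<close> is the identity of \<open>H2 K\<close>, so this is what puts the
  class into the kernel of the comparison map. Every member of the coset is the coboundary of some
  function, possibly unbounded, and translating \<open>B2 K\<close> by it gives \<open>B2 K\<close>
  again.\<close>

lemma comparison_bclass_cob1:
  assumes "group K"
  shows "comparison K (bclass K (cob1 K \<phi>)) = B2 K"
proof
  show "comparison K (bclass K (cob1 K \<phi>)) \<subseteq> B2 K"
  proof
    fix c assume "c \<in> comparison K (bclass K (cob1 K \<phi>))"
    then obtain \<alpha> \<beta> where "c = (\<lambda>p. cob1 K \<alpha> p + (cob1 K \<beta> p + cob1 K \<phi> p))"
      by (auto simp: comparison_def bclass_def r_coset_def mult_Zb2 mult_Z2 B2_def Bb2_def)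
    then have "c = cob1 K (\<lambda>h. \<alpha> h + (\<beta> h + \<phi> h))"
      by (simp add: cob1_add fun_eq_iff)
    then show "c \<in> B2 K" by (simp add: B2_def)
  qed
next
  show "B2 K \<subseteq> comparison K (bclass K (cob1 K \<phi>))"
  proof
    fix c assume "c \<in> B2 K"
    then obtain \<alpha> where \<alpha>: "c = cob1 K \<alpha>" by (auto simp: B2_def)
    have "cob1 K (\<lambda>_. 0) \<in> Bb2 K" by (auto simp: Bb2_def)
    moreover have "cob1 K \<phi> = cob1 K (\<lambda>_. 0) \<otimes>\<^bsub>Zb2 K\<^esub> cob1 K \<phi>"
      by (simp add: mult_Zb2 cob1_zero)
    ultimately have "cob1 K \<phi> \<in> bclass K (cob1 K \<phi>)"
      unfolding bclass_def r_coset_def by blast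
    \<comment> \<open>Subtracting \<open>\<phi>\<close> from the primitive of \<open>c\<close>
      compensates for the representative \<open>cob1 K \<phi>\<close>.\<close>
    moreover have "c = cob1 K (\<lambda>h. \<alpha> h + - \<phi> h) \<otimes>\<^bsub>Z2 K\<^esub> cob1 K \<phi>"
      unfolding mult_Z2 cob1_add cob1_minus \<alpha> by simp
    then have "c \<in> B2 K #>\<^bsub>Z2 K\<^esub> cob1 K \<phi>"
      unfolding r_coset_def B2_def by blast
    ultimately show "c \<in> comparison K (bclass K (cob1 K \<phi>))"
      unfolding comparison_def by blast
  qed
qed

section \<open>Membership and inverses in the kernel of the comparison map\<close>

lemma bclass_cob1_in_Hb2:
  assumes "group K" "\<exists>M. \<forall>p. \<bar>cob1 K \<phi> p\<bar> \<le> M"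
  shows "bclass K (cob1 K \<phi>) \<in> carrier (Hb2 K)"
  using comparison_bclass_cob1[OF assms(1)] cob1_in_Zb2[OF assms]
  by (auto simp: Hb2_def kernel_def full_Hb2_def H2_def FactGroup_def RCOSETS_def bclass_def)

text \<open>\<open>Hb2 K\<close> is \<open>full_Hb2 K\<close> with a smaller carrier, so
  \<open>m_inv\<close> is unfolded: a two-sided inverse is exhibited inside the kernel, and its
  uniqueness is inherited from the ambient quotient group.\<close>

lemma inv_Hb2_bclass_cob1:
  assumes "group K" and bd: "\<exists>M. \<forall>p. \<bar>cob1 K \<phi> p\<bar> \<le> M"
  shows "inv\<^bsub>Hb2 K\<^esub> bclass K (cob1 K \<phi>) = bclass K (cob1 K (\<lambda>h. - \<phi> h))"
proof -
  interpret N: normal "Bb2 K" "Zb2 K" by (rule normal_Bb2[OF assms(1)])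
  interpret F: group "full_Hb2 K" unfolding full_Hb2_def by (rule N.factorgroup_is_group)
  let ?X = "bclass K (cob1 K \<phi>)" and ?Y = "bclass K (cob1 K (\<lambda>h. - \<phi> h))"
  have bd': "\<exists>M. \<forall>p. \<bar>cob1 K (\<lambda>h. - \<phi> h) p\<bar> \<le> M"
    using bd by (simp add: cob1_minus)
  have XY: "?X \<in> carrier (Hb2 K)" "?Y \<in> carrier (Hb2 K)"
    using bclass_cob1_in_Hb2[OF assms(1)] bd bd' by auto
  have sub: "carrier (Hb2 K) \<subseteq> carrier (full_Hb2 K)"
    and ops: "mult (Hb2 K) = mult (full_Hb2 K)" "one (Hb2 K) = one (full_Hb2 K)"
    by (auto simp: Hb2_def kernel_def)
  have [simp]: "cob1 K \<phi> \<in> carrier (Zb2 K)" "cob1 K (\<lambda>h. - \<phi> h) \<in> carrier (Zb2 K)"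
    using cob1_in_Zb2[OF assms(1)] bd bd' by auto
  have sum0: "cob1 K (\<lambda>h. - \<phi> h) \<otimes>\<^bsub>Zb2 K\<^esub> cob1 K \<phi> = \<one>\<^bsub>Zb2 K\<^esub>"
    "cob1 K \<phi> \<otimes>\<^bsub>Zb2 K\<^esub> cob1 K (\<lambda>h. - \<phi> h) = \<one>\<^bsub>Zb2 K\<^esub>"
    by (simp_all add: mult_Zb2 one_Zb2 cob1_minus)
  have inv: "?Y \<otimes>\<^bsub>full_Hb2 K\<^esub> ?X = \<one>\<^bsub>full_Hb2 K\<^esub>" "?X \<otimes>\<^bsub>full_Hb2 K\<^esub> ?Y = \<one>\<^bsub>full_Hb2 K\<^esub>"
    unfolding bclass_def full_Hb2_def
    by (simp_all add: FactGroup_def N.rcos_sum sum0 N.subset)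
  show ?thesis
    unfolding m_inv_def
  proof (rule the_equality)
    show "?Y \<in> carrier (Hb2 K) \<and> ?X \<otimes>\<^bsub>Hb2 K\<^esub> ?Y = \<one>\<^bsub>Hb2 K\<^esub> \<and> ?Y \<otimes>\<^bsub>Hb2 K\<^esub> ?X = \<one>\<^bsub>Hb2 K\<^esub>"
      using XY inv ops by simp
  next
    fix Y assume "Y \<in> carrier (Hb2 K) \<and> ?X \<otimes>\<^bsub>Hb2 K\<^esub> Y = \<one>\<^bsub>Hb2 K\<^esub> \<and> Y \<otimes>\<^bsub>Hb2 K\<^esub> ?X = \<one>\<^bsub>Hb2 K\<^esub>"
    then show "Y = ?Y"
      using F.inv_unique[of Y ?X ?Y] XY sub inv ops by auto
  qed
qed

text \<open>Members of the coset of \<open>c\<close> differ by \<open>cob1 L \<phi>\<close> with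
  \<open>\<phi>\<close> bounded, and this pulls back to the coboundary of the bounded function
  \<open>\<phi> \<circ> f\<close>; hence all cosets in the union coincide. The cocycle condition is
  asked of the pulled-back cochain, which for the Euler cocycle is an explicit coboundary.\<close>

lemma pullback_bclass:
  assumes f: "\<And>h. h \<in> carrier K \<Longrightarrow> f h \<in> carrier L"
      "\<And>g h. g \<in> carrier K \<Longrightarrow> h \<in> carrier K \<Longrightarrow> f (g \<otimes>\<^bsub>K\<^esub> h) = f g \<otimes>\<^bsub>L\<^esub> f h"
    and K: "group K" and Zb: "pullback_cochain K f c \<in> carrier (Zb2 K)"
  shows "pullback K f (bclass L c) = bclass K (pullback_cochain K f c)"
proof -
  interpret Z: comm_group "Zb2 K" by (rule comm_group_Zb2)
  have "bclass K (pullback_cochain K f c') = bclass K (pullback_cochain K f c)"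
    if "c' \<in> bclass L c" for c'
  proof -
    obtain \<phi> M where \<phi>: "\<forall>h\<in>carrier L. \<bar>\<phi> h\<bar> \<le> M" "c' = (\<lambda>p. cob1 L \<phi> p + c p)"
      using \<open>c' \<in> bclass L c\<close> by (auto simp: bclass_def r_coset_def mult_Zb2 Bb2_def)
    have "cob1 K (\<phi> \<circ> f) \<in> Bb2 K"
      unfolding Bb2_def using \<phi>(1) f(1) by (intro CollectI exI[of _ "\<phi> \<circ> f"]) auto
    moreover have "pullback_cochain K f c' = cob1 K (\<phi> \<circ> f) \<otimes>\<^bsub>Zb2 K\<^esub> pullback_cochain K f c"
      by (auto simp: \<phi>(2) mult_Zb2 pullback_cochain_def cob1_def f fun_eq_iff)
    ultimately have "pullback_cochain K f c' \<in> bclass K (pullback_cochain K f c)"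
      unfolding bclass_def r_coset_def by blast
    then show ?thesis
      using Z.repr_independence subgroup_Bb2[OF K] Zb by (metis bclass_def)
  qed
  \<comment> \<open>The union must not be empty: the zero cochain exhibits \<open>c\<close> as a
    member of its own coset.\<close>
  moreover have "c \<in> bclass L c"
    unfolding bclass_def r_coset_def mult_Zb2 Bb2_def
    by (intro UN_I[of "cob1 L (\<lambda>_. 0)"]) (auto simp: cob1_zero)
  ultimately show ?thesis
    unfolding pullback_def by blast
qed

section \<open>Homeomorphisms of the line commuting with the unit translation\<close>

lemma mult_Homeo_line [simp]: "f \<otimes>\<^bsub>Homeo_line\<^esub> g = f \<circ> g"
  and one_Homeo_line [simp]: "\<one>\<^bsub>Homeo_line\<^esub> = id"
  and mult_Homeo_tilde [simp]: "f \<otimes>\<^bsub>Homeo_tilde\<^esub> g = f \<circ> g"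
  and one_Homeo_tilde [simp]: "\<one>\<^bsub>Homeo_tilde\<^esub> = id"
  and mult_Homeo_circle [simp]: "u \<otimes>\<^bsub>Homeo_circle\<^esub> v = u \<circ> v"
  by (simp_all add: Homeo_line_def Homeo_tilde_def Homeo_circle_def)

lemma Homeo_line_inverse:
  assumes "f \<in> carrier Homeo_line"
  obtains g where "g \<in> carrier Homeo_line" "\<And>r. f (g r) = r" "\<And>r. g (f r) = r"
proof -
  obtain g where g: "homeomorphism UNIV UNIV f g" and f: "strict_mono f"
    using assms by (auto simp: Homeo_line_def)
  have fg: "f (g r) = r" "g (f r) = r" for r
    using g by (auto simp: homeomorphism_def)
  have "strict_mono g"
    by (rule strict_monoI) (metis f fg(1) strict_mono_less)
  then have "g \<in> carrier Homeo_line"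
    using homeomorphism_symD[OF g] by (auto simp: Homeo_line_def)
  then show thesis using that fg by blast
qed

lemma group_Homeo_line: "group Homeo_line"
proof (rule groupI)
  fix f g assume "f \<in> carrier Homeo_line" "g \<in> carrier Homeo_line"
  then show "f \<otimes>\<^bsub>Homeo_line\<^esub> g \<in> carrier Homeo_line"
    unfolding Homeo_line_def
    by (auto intro: homeomorphism_compose strict_mono_o)
next
  show "\<one>\<^bsub>Homeo_line\<^esub> \<in> carrier Homeo_line"
    using homeomorphism_ident[of "UNIV :: real set"]
    by (auto simp: Homeo_line_def id_def strict_mono_def)
next
  fix f assume "f \<in> carrier Homeo_line"
  then show "\<exists>g\<in>carrier Homeo_line. g \<otimes>\<^bsub>Homeo_line\<^esub> f = \<one>\<^bsub>Homeo_line\<^esub>"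
    by (rule Homeo_line_inverse) (auto simp: fun_eq_iff)
qed (auto simp: comp_assoc)

lemma Homeo_tilde_inverse:
  assumes "F \<in> carrier Homeo_tilde"
  obtains F' where "F' \<in> carrier Homeo_tilde" "\<And>r. F (F' r) = r" "\<And>r. F' (F r) = r"
proof -
  have F: "F \<in> carrier Homeo_line" "\<And>r. F (r + 1) = F r + 1"
    using assms by (auto simp: Homeo_tilde_def)
  obtain F' where F': "F' \<in> carrier Homeo_line" "\<And>r. F (F' r) = r" "\<And>r. F' (F r) = r"
    using Homeo_line_inverse[OF F(1)] by blast
  have "F' (r + 1) = F' r + 1" for r
    by (metis F(2) F'(2,3))
  then have "F' \<in> carrier Homeo_tilde"
    using F'(1) by (simp add: Homeo_tilde_def)
  then show thesis using that F' by blast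
qed

lemma group_Homeo_tilde: "group Homeo_tilde"
proof (rule groupI)
  interpret L: group Homeo_line by (rule group_Homeo_line)
  fix f g assume "f \<in> carrier Homeo_tilde" "g \<in> carrier Homeo_tilde"
  then show "f \<otimes>\<^bsub>Homeo_tilde\<^esub> g \<in> carrier Homeo_tilde"
    using L.m_closed[of f g] by (auto simp: Homeo_tilde_def)
next
  interpret L: group Homeo_line by (rule group_Homeo_line)
  show "\<one>\<^bsub>Homeo_tilde\<^esub> \<in> carrier Homeo_tilde"
    using L.one_closed by (simp add: Homeo_tilde_def)
next
  fix f assume "f \<in> carrier Homeo_tilde"
  then show "\<exists>g\<in>carrier Homeo_tilde. g \<otimes>\<^bsub>Homeo_tilde\<^esub> f = \<one>\<^bsub>Homeo_tilde\<^esub>"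
    by (rule Homeo_tilde_inverse) (auto simp: fun_eq_iff)
qed (auto simp: comp_assoc)

lemma Homeo_tilde_add_int:
  assumes "F \<in> carrier Homeo_tilde"
  shows "F (r + of_int n) = F r + of_int n"
proof (induction n rule: int_induct[where k = 0])
  case (step1 i)
  then show ?case
    using assms by (simp add: Homeo_tilde_def add.assoc[symmetric])
next
  case (step2 i)
  have "F (r + of_int (i - 1) + 1) = F (r + of_int (i - 1)) + 1"
    using assms by (simp add: Homeo_tilde_def del: of_int_diff)
  with step2 show ?case by (simp add: algebra_simps)
qed simp

lemma Homeo_tilde_strict_mono: "F \<in> carrier Homeo_tilde \<Longrightarrow> strict_mono F"
  by (simp add: Homeo_tilde_def Homeo_line_def)

text \<open>The point \<open>r\<close> lies between two consecutive integer translates of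
  \<open>s\<close>, and \<open>F\<close> preserves order and integer translations. All estimates of
  displacements below rest on this.\<close>

lemma Homeo_tilde_between:
  assumes F: "F \<in> carrier Homeo_tilde"
  shows "F s + of_int \<lfloor>r - s\<rfloor> \<le> F r" "F r < F s + of_int \<lfloor>r - s\<rfloor> + 1"
proof -
  have "F (s + of_int \<lfloor>r - s\<rfloor>) \<le> F r"
    unfolding strict_mono_less_eq[OF Homeo_tilde_strict_mono[OF F]] by linarith
  then show "F s + of_int \<lfloor>r - s\<rfloor> \<le> F r"
    by (simp add: Homeo_tilde_add_int[OF F])
  have "F r < F (s + of_int (\<lfloor>r - s\<rfloor> + 1))"
    unfolding strict_mono_less[OF Homeo_tilde_strict_mono[OF F]] by linarith
  then show "F r < F s + of_int \<lfloor>r - s\<rfloor> + 1"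
    unfolding Homeo_tilde_add_int[OF F] by simp
qed

lemma translation_in_Homeo_tilde: "(\<lambda>r. r + c) \<in> carrier Homeo_tilde"
proof -
  have "homeomorphism UNIV UNIV (\<lambda>r::real. r + c) (\<lambda>r. r - c)"
    by (intro homeomorphismI continuous_intros) auto
  then show ?thesis
    by (auto simp: Homeo_tilde_def Homeo_line_def strict_mono_def)
qed

lemma Homeo_tilde_shift:
  assumes "F \<in> carrier Homeo_tilde"
  shows "(\<lambda>r. F r + c) \<in> carrier Homeo_tilde"
proof -
  interpret group Homeo_tilde by (rule group_Homeo_tilde)
  show ?thesis
    using m_closed[OF translation_in_Homeo_tilde[of c] assms] by (simp add: comp_def)
qed

section \<open>The Euler cocycle on projected lifts\<close>

lemma to_circle_eq_iff: "to_circle r = to_circle s \<longleftrightarrow> r - s \<in> \<int>"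
  by (rule circle.abs_eq_iff)

lemma to_circle_cases: obtains r where "c = to_circle r"
  using Quotient3_circle Quotient3_abs_rep by metis

text \<open>The description \<open>THE\<close> in \<open>circle_proj\<close> denotes something:
  compatibility of \<open>F\<close> with integer translations gives existence through
  representatives, and surjectivity of \<open>to_circle\<close> gives uniqueness.\<close>

lemma circle_proj_to_circle:
  assumes F: "F \<in> carrier Homeo_tilde"
  shows "circle_proj F (to_circle r) = to_circle (F r)"
proof -
  have wd: "to_circle (F r) = to_circle (F s)" if "to_circle r = to_circle s" for r s
  proof -
    obtain n where "r - s = of_int n"
      using \<open>to_circle r = to_circle s\<close> unfolding to_circle_eq_iff by (rule Ints_cases)
    then have "r = s + of_int n" by simp
    then show ?thesis
      by (simp add: Homeo_tilde_add_int[OF F] to_circle_eq_iff)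
  qed
  have "\<exists>!f. \<forall>r. f (to_circle r) = to_circle (F r)"
  proof (rule ex1I)
    show "\<forall>r. (to_circle \<circ> F \<circ> rep_circle) (to_circle r) = to_circle (F r)"
      by (auto intro: wd Quotient3_abs_rep[OF Quotient3_circle])
  next
    fix f assume f: "\<forall>r. f (to_circle r) = to_circle (F r)"
    show "f = to_circle \<circ> F \<circ> rep_circle"
    proof
      fix c
      show "f c = (to_circle \<circ> F \<circ> rep_circle) c"
        using f Quotient3_abs_rep[OF Quotient3_circle, of c] by (metis comp_apply)
    qed
  qed
  from theI'[OF this] show ?thesis
    unfolding circle_proj_def by blast
qed

lemma circle_proj_eq_iff:
  assumes "F \<in> carrier Homeo_tilde" "F' \<in> carrier Homeo_tilde"
  shows "circle_proj F = circle_proj F' \<longleftrightarrow> (\<forall>r. F r - F' r \<in> \<int>)"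
proof
  assume "circle_proj F = circle_proj F'"
  then show "\<forall>r. F r - F' r \<in> \<int>"
    using circle_proj_to_circle assms to_circle_eq_iff by metis
next
  assume "\<forall>r. F r - F' r \<in> \<int>"
  then show "circle_proj F = circle_proj F'"
    using circle_proj_to_circle assms to_circle_eq_iff to_circle_cases by (metis ext)
qed

lemma circle_proj_comp:
  assumes "F \<in> carrier Homeo_tilde" "F' \<in> carrier Homeo_tilde"
  shows "circle_proj (F \<circ> F') = circle_proj F \<circ> circle_proj F'"
proof
  interpret group Homeo_tilde by (rule group_Homeo_tilde)
  fix c
  obtain r where "c = to_circle r" by (rule to_circle_cases)
  then show "circle_proj (F \<circ> F') c = (circle_proj F \<circ> circle_proj F') c"
    using assms m_closed[OF assms] by (simp add: circle_proj_to_circle)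
qed

text \<open>The circle carries the quotient topology, so openness of a preimage is tested after
  pulling back to the line, where it is continuity of \<open>F\<close>.\<close>

lemma continuous_circle_proj:
  assumes F: "F \<in> carrier Homeo_tilde"
  shows "continuous_on UNIV (circle_proj F)"
proof -
  have "continuous_on UNIV F"
    using F by (auto simp: Homeo_tilde_def Homeo_line_def homeomorphism_def)
  moreover have "to_circle -` (circle_proj F -` U) = F -` (to_circle -` U)" for U
    by (auto simp: circle_proj_to_circle[OF F])
  ultimately show ?thesis
    by (simp add: continuous_on_open_vimage open_circle_def)
qed

lemma circle_proj_in_Homeo_circle:
  assumes F: "F \<in> carrier Homeo_tilde"
  shows "circle_proj F \<in> carrier Homeo_circle"
proof -
  obtain F' where F': "F' \<in> carrier Homeo_tilde" "\<And>r. F (F' r) = r" "\<And>r. F' (F r) = r"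
    using Homeo_tilde_inverse[OF F] by blast
  have "circle_proj F (circle_proj F' c) = c" "circle_proj F' (circle_proj F c) = c" for c
    using F' F by (metis circle_proj_to_circle to_circle_cases)+
  then have "homeomorphism UNIV UNIV (circle_proj F) (circle_proj F')"
    by (intro homeomorphismI continuous_circle_proj F F'(1)) auto
  then show ?thesis
    using F circle_proj_to_circle[OF F] by (auto simp: Homeo_circle_def)
qed

text \<open>Subtracting the floor brings the value at \<open>0\<close> into the unit interval. For
  uniqueness, two lifts of one circle map differ by an integer at each point; this integer is
  constant, and the normalization at \<open>0\<close> fixes it.\<close>

lemma sigma_circle_proj:
  assumes F: "F \<in> carrier Homeo_tilde"
  shows "sigma (circle_proj F) = (\<lambda>r. F r - of_int \<lfloor>F 0\<rfloor>)"
  unfolding sigma_def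
proof (rule the_equality)
  have F1: "(\<lambda>r. F r - of_int \<lfloor>F 0\<rfloor>) \<in> carrier Homeo_tilde"
    using Homeo_tilde_shift[OF F, of "- of_int \<lfloor>F 0\<rfloor>"] by simp
  show "(\<lambda>r. F r - of_int \<lfloor>F 0\<rfloor>) \<in> carrier Homeo_tilde \<and>
      circle_proj (\<lambda>r. F r - of_int \<lfloor>F 0\<rfloor>) = circle_proj F \<and> F 0 - of_int \<lfloor>F 0\<rfloor> \<in> {0..<1}"
    using F1 circle_proj_eq_iff[OF F1 F] by (simp, linarith)
  fix E assume E: "E \<in> carrier Homeo_tilde \<and> circle_proj E = circle_proj F \<and> E 0 \<in> {0..<1}"
  show "E = (\<lambda>r. F r - of_int \<lfloor>F 0\<rfloor>)"
  proof -
    have int: "E r - F r \<in> \<int>" for r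
      using E circle_proj_eq_iff[of E F] F by blast
    obtain k where k: "E 0 - F 0 = of_int k"
      using int Ints_cases by blast
    have k': "k = - \<lfloor>F 0\<rfloor>"
      using E k by (simp, linarith)
    show ?thesis
    proof
      fix r
      obtain j where j: "E r - F r = of_int j"
        using int Ints_cases by blast
      \<comment> \<open>Constancy needs no continuity: \<open>E r - E 0\<close> and
        \<open>F r - F 0\<close> lie in the same half-open unit interval starting at
        \<open>\<lfloor>r\<rfloor>\<close>, so the integers \<open>j\<close> and \<open>k\<close>
        are less than \<open>1\<close> apart.\<close>
      have "\<bar>(E r - F r) - (E 0 - F 0)\<bar> < 1"
        using Homeo_tilde_between[OF conjunct1[OF E], where s = 0 and r = r]
          Homeo_tilde_between[OF F, where s = 0 and r = r] by linarith
      then have "j = k"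
        unfolding j k by linarith
      then show "E r = F r - of_int \<lfloor>F 0\<rfloor>"
        using j k' by simp
    qed
  qed
qed

text \<open>The product of the normalized lifts of the two factors is again a lift of the composite,
  so it differs from the normalized one by an integer translation, which collects the three floors
  that were subtracted.\<close>

lemma euler_cocycle_circle_proj:
  assumes F: "F \<in> carrier Homeo_tilde" and E: "E \<in> carrier Homeo_tilde"
  shows "euler_cocycle (circle_proj F, circle_proj E) = \<lfloor>F (E 0)\<rfloor> - \<lfloor>F 0\<rfloor> - \<lfloor>E 0\<rfloor>"
proof -
  interpret T: group Homeo_tilde by (rule group_Homeo_tilde)
  define n where "n = \<lfloor>F (E 0)\<rfloor> - \<lfloor>F 0\<rfloor> - \<lfloor>E 0\<rfloor>"
  let ?s = "\<lambda>F r. F r - of_int \<lfloor>F 0 :: real\<rfloor>" and ?\<tau> = "\<lambda>r::real. r + of_int n"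
  have FE: "F \<circ> E \<in> carrier Homeo_tilde"
    using T.m_closed[OF F E] by simp
  have s: "?s F \<in> carrier Homeo_tilde" if "F \<in> carrier Homeo_tilde" for F
    using Homeo_tilde_shift[OF that, of "- of_int \<lfloor>F 0\<rfloor>"] by simp
  \<comment> \<open>\<open>F\<close> and \<open>F \<circ> E\<close> commute with integer
    translations, so the inner shift by \<open>\<lfloor>E 0\<rfloor>\<close> and the shift by
    \<open>n\<close> can both be moved outside.\<close>
  have "?s F (?s E r) = ?s (F \<circ> E) (?\<tau> r)" for r
    using Homeo_tilde_add_int[OF FE, of r n] Homeo_tilde_add_int[OF F, of "E r" "- \<lfloor>E 0\<rfloor>"]
    by (simp add: n_def)
  then have "?s F \<otimes>\<^bsub>Homeo_tilde\<^esub> ?s E = ?s (F \<circ> E) \<otimes>\<^bsub>Homeo_tilde\<^esub> ?\<tau>"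
    by (simp add: fun_eq_iff)
  then have "inv\<^bsub>Homeo_tilde\<^esub> ?s (F \<circ> E) \<otimes>\<^bsub>Homeo_tilde\<^esub> (?s F \<otimes>\<^bsub>Homeo_tilde\<^esub> ?s E) = ?\<tau>"
    using T.inv_solve_left[OF translation_in_Homeo_tilde s[OF FE] T.m_closed[OF s[OF F] s[OF E]]]
    by metis
  then have "inv\<^bsub>Homeo_tilde\<^esub> ?s (F \<circ> E) \<otimes>\<^bsub>Homeo_tilde\<^esub> ?s F \<otimes>\<^bsub>Homeo_tilde\<^esub> ?s E = ?\<tau>"
    using T.m_assoc[OF T.inv_closed[OF s[OF FE]] s[OF F] s[OF E]] by argo
  \<comment> \<open>A translation determines its integer, so the description in
    \<open>euler_cocycle\<close> picks out \<open>n\<close>.\<close>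
  moreover have "(\<lambda>r::real. r + of_int n) = (\<lambda>r. r + of_int m) \<longleftrightarrow> n = m" for m
    by (auto simp: fun_eq_iff)
  moreover have "circle_proj F \<otimes>\<^bsub>Homeo_circle\<^esub> circle_proj E = circle_proj (F \<circ> E)"
    using circle_proj_comp[OF F E] by simp
  ultimately show ?thesis
    unfolding euler_cocycle_def using circle_proj_in_Homeo_circle F E
    by (simp add: sigma_circle_proj FE del: mult_Homeo_circle mult_Homeo_tilde flip: n_def)
qed

section \<open>The bounded Euler class of an action given by lifts\<close>

lemma bounded_cob1_floor:
  assumes K: "group K" and B: "B \<in> hom K Homeo_tilde"
  shows "\<exists>M. \<forall>p. \<bar>cob1 K (\<lambda>h. \<lfloor>B h 0\<rfloor>) p\<bar> \<le> M"
proof -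
  have "\<bar>cob1 K (\<lambda>h. \<lfloor>B h 0\<rfloor>) p\<bar> \<le> 1" for p
  proof (cases "p \<in> carrier K \<times> carrier K")
    case True
    then obtain g h where p: "p = (g, h)" "g \<in> carrier K" "h \<in> carrier K" by auto
    have g: "B g \<in> carrier Homeo_tilde"
      using hom_in_carrier[OF B p(2)] .
    have "B (g \<otimes>\<^bsub>K\<^esub> h) 0 = B g (B h 0)"
      using hom_mult[OF B p(2,3)] by simp
    \<comment> \<open>Once \<open>\<lfloor>B h 0\<rfloor>\<close> is split off from
      \<open>B g (B h 0)\<close>, what remains exceeds \<open>B g 0\<close> by less than
      \<open>1\<close>, so the floors leave a defect of at most \<open>1\<close>.\<close>
    moreover have "B g 0 + of_int \<lfloor>B h 0\<rfloor> \<le> B g (B h 0)"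
      "B g (B h 0) < B g 0 + of_int \<lfloor>B h 0\<rfloor> + 1"
      using Homeo_tilde_between[OF g, where s = 0 and r = "B h 0"] by simp_all
    ultimately have "\<bar>\<lfloor>B g 0\<rfloor> - \<lfloor>B (g \<otimes>\<^bsub>K\<^esub> h) 0\<rfloor> + \<lfloor>B h 0\<rfloor>\<bar> \<le> 1"
      by linarith
    then show ?thesis
      using p by (simp add: cob1_def)
  qed (cases p; auto simp: cob1_def)
  then show ?thesis by blast
qed

lemma eu_circle_action:
  assumes K: "group K" and B: "B \<in> hom K Homeo_tilde"
  shows "eu K (circle_action B) = bclass K (cob1 K (\<lambda>h. - \<lfloor>B h 0\<rfloor>))"
proof -
  have carr: "B h \<in> carrier Homeo_tilde" if "h \<in> carrier K" for h
    using hom_in_carrier[OF B that] .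
  have mult: "B (g \<otimes>\<^bsub>K\<^esub> h) = B g \<circ> B h" if "g \<in> carrier K" "h \<in> carrier K" for g h
    using hom_mult[OF B that] by simp
  \<comment> \<open>An equality of cochains, not only of classes. The Euler cocycle has the floor of
    the product with a plus sign while \<open>cob1\<close> has it with a minus sign; this is the
    source of the sign in the theorem.\<close>
  have pb: "pullback_cochain K (circle_action B) euler_cocycle = cob1 K (\<lambda>h. - \<lfloor>B h 0\<rfloor>)"
    by (auto simp: pullback_cochain_def cob1_def circle_action_def euler_cocycle_circle_proj
        carr mult fun_eq_iff)
  have "cob1 K (\<lambda>h. - \<lfloor>B h 0\<rfloor>) \<in> carrier (Zb2 K)"
    using cob1_in_Zb2[OF K] bounded_cob1_floor[OF K B] by (simp add: cob1_minus)
  then show ?thesis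
    unfolding eu_def pb[symmetric]
    by (intro pullback_bclass K)
      (simp_all add: circle_action_def circle_proj_in_Homeo_circle circle_proj_comp carr mult)
qed

section \<open>The order is read off the realization\<close>

text \<open>The order axioms pass from the unspecified ordering witnessing
  \<open>P \<in> LO G\<close> to the relation read off from \<open>P\<close>, since the two agree on
  the carrier.\<close>

lemma left_ordering_cone_less:
  assumes "group G" "P \<in> LO G"
  shows "left_ordering G (cone_less G P)"
proof -
  interpret group G by fact
  obtain lt where lt: "left_ordering G lt" "P = {g \<in> carrier G. lt \<one>\<^bsub>G\<^esub> g}"
    using assms(2) by (auto simp: LO_def)
  note eq = cone_less_eq[OF assms(1) lt]
  show ?thesis
    unfolding left_ordering_def
  proof (intro conjI ballI impI)
    fix a b c
    assume c: "a \<in> carrier G" "b \<in> carrier G" "c \<in> carrier G"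
    show "cone_less G P a c" if "cone_less G P a b" "cone_less G P b c"
    proof -
      have "lt a b" "lt b c" using that eq c by auto
      then show ?thesis using eq[of a c] c lt(1) unfolding left_ordering_def by blast
    qed
    show "cone_less G P (c \<otimes>\<^bsub>G\<^esub> a) (c \<otimes>\<^bsub>G\<^esub> b)" if "cone_less G P a b"
    proof -
      have "lt a b" using that eq c by auto
      then have "lt (c \<otimes>\<^bsub>G\<^esub> a) (c \<otimes>\<^bsub>G\<^esub> b)"
        using c lt(1) unfolding left_ordering_def by blast
      then show ?thesis using eq c by simp
    qed
  next
    fix a assume a: "a \<in> carrier G"
    then have "\<not> lt a a"
      using lt(1) unfolding left_ordering_def by blast
    then show "\<not> cone_less G P a a"
      using eq a by simp
  next
    fix a b assume c: "a \<in> carrier G" "b \<in> carrier G"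
    then have "lt a b \<or> a = b \<or> lt b a"
      using lt(1) unfolding left_ordering_def by blast
    then show "cone_less G P a b \<or> a = b \<or> cone_less G P b a"
      using eq c by auto
  qed
qed

text \<open>Induction on the number \<open>n\<close> of points already placed: the next point goes
  above all of them, below all of them, or to the midpoint of the gap between its two neighbours,
  and each choice respects the order.\<close>

lemma realization_points_strict_mono:
  assumes G: "group G" and P: "P \<in> LO G" and e: "enumeration G e"
    and t: "realization_points G P e t"
  shows "j < n \<Longrightarrow> k < n \<Longrightarrow> cone_less G P (e j) (e k) \<Longrightarrow> t (e j) < t (e k)"
proof (induction n arbitrary: j k)
  case (Suc n)
  let ?lt = "cone_less G P"
  have carr: "e i \<in> carrier G" for i
    using e by (auto simp: enumeration_def bij_betw_def)
  have inj: "e i = e j \<Longrightarrow> i = j" for i j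
    using e by (auto simp: enumeration_def bij_betw_def inj_on_def)
  have lo: "left_ordering G ?lt" by (rule left_ordering_cone_less[OF G P])
  have irr: "\<not> ?lt (e i) (e i)" for i
    using lo carr unfolding left_ordering_def by blast
  have tr: "?lt (e i) (e j) \<Longrightarrow> ?lt (e j) (e k) \<Longrightarrow> ?lt (e i) (e k)" for i j k
    using lo carr unfolding left_ordering_def by blast
  have tot: "i = j \<or> ?lt (e i) (e j) \<or> ?lt (e j) (e i)" for i j
    using lo carr inj unfolding left_ordering_def by blast
  have IH: "t (e i) < t (e j)" if "i < n" "j < n" "?lt (e i) (e j)" for i j
    using Suc.IH that .
  \<comment> \<open>Pairs of earlier points are covered by the induction hypothesis, so only
    comparisons with the new point \<open>e n\<close> remain. For \<open>n = 0\<close> there are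
    none.\<close>
  have new: "(\<forall>i<n. ?lt (e i) (e n) \<longrightarrow> t (e i) < t (e n)) \<and> (\<forall>i<n. ?lt (e n) (e i) \<longrightarrow> t (e n) < t (e i))"
  proof (cases "n = 0")
    case False
    then have n: "n \<ge> 1" by simp
    show ?thesis
    proof (cases "\<forall>i<n. ?lt (e i) (e n)")
      case True
      then have "t (e n) = (MAX j\<in>{..<n}. t (e j)) + 1"
        using t n unfolding realization_points_def by auto
      moreover have "t (e i) \<le> (MAX j\<in>{..<n}. t (e j))" if "i < n" for i
        using that by (intro Max_ge) auto
      moreover have "\<not> ?lt (e n) (e i)" if "i < n" for i
        using True that tr irr by blast
      ultimately show ?thesis by (smt (verit))
    next
      case no_max: False
      show ?thesis
      proof (cases "\<forall>i<n. ?lt (e n) (e i)")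
        case True
        then have "t (e n) = (MIN j\<in>{..<n}. t (e j)) - 1"
          using t n no_max unfolding realization_points_def by auto
        moreover have "t (e i) \<ge> (MIN j\<in>{..<n}. t (e j))" if "i < n" for i
          using that by (intro Min_le) auto
        moreover have "\<not> ?lt (e i) (e n)" if "i < n" for i
          using True that tr irr by blast
        ultimately show ?thesis by (smt (verit))
      next
        case no_min: False
        \<comment> \<open>The indices of earlier points below and above \<open>e n\<close>. The
          neighbours of \<open>e n\<close> are chosen by extremal value of \<open>t\<close> on these
          finite sets; the induction hypothesis then shows that they are adjacent in the group
          order.\<close>
        define L where "L = {i. i < n \<and> ?lt (e i) (e n)}"
        define U where "U = {i. i < n \<and> ?lt (e n) (e i)}"
        have fin: "finite L" "finite U" by (auto simp: L_def U_def)
        have "U \<noteq> {}" "L \<noteq> {}"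
          using no_max no_min tot by (auto simp: U_def L_def) (metis less_irrefl)+
        obtain m where m: "m \<in> L" "\<And>i. i \<in> L \<Longrightarrow> t (e i) \<le> t (e m)"
          using ex_is_arg_min_if_finite[OF fin(1) \<open>L \<noteq> {}\<close>, of "\<lambda>i. - t (e i)"]
          by (auto simp: is_arg_min_linorder)
        obtain M where M: "M \<in> U" "\<And>i. i \<in> U \<Longrightarrow> t (e M) \<le> t (e i)"
          using ex_is_arg_min_if_finite[OF fin(2) \<open>U \<noteq> {}\<close>, of "\<lambda>i. t (e i)"]
          by (auto simp: is_arg_min_linorder)
        \<comment> \<open>A point between the neighbours would have a \<open>t\<close>-value
          strictly between theirs, hence lie in neither \<open>L\<close> nor \<open>U\<close>,
          although totality puts every earlier index into one of them.\<close>
        have "\<not> (\<exists>j<n. ?lt (e m) (e j) \<and> ?lt (e j) (e M))"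
        proof
          assume "\<exists>j<n. ?lt (e m) (e j) \<and> ?lt (e j) (e M)"
          then obtain j where j: "j < n" "?lt (e m) (e j)" "?lt (e j) (e M)" by blast
          then have "t (e m) < t (e j)" "t (e j) < t (e M)"
            using IH m(1) M(1) by (auto simp: L_def U_def)
          then have "j \<notin> L" "j \<notin> U" using m(2) M(2) by force+
          then show False using tot[of j n] j(1) by (auto simp: L_def U_def)
        qed
        moreover have "m < n" "M < n" "?lt (e m) (e n)" "?lt (e n) (e M)"
          using m(1) M(1) by (auto simp: L_def U_def)
        moreover have "\<forall>m<n. \<forall>M<n. ?lt (e m) (e n) \<and> ?lt (e n) (e M) \<and>
            \<not> (\<exists>j<n. ?lt (e m) (e j) \<and> ?lt (e j) (e M)) \<longrightarrow> t (e n) = (t (e m) + t (e M)) / 2"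
          using t n no_max no_min unfolding realization_points_def by presburger
        ultimately have tn: "t (e n) = (t (e m) + t (e M)) / 2"
          by blast
        have "t (e m) < t (e M)"
          using IH[of m M] m(1) M(1) tr by (auto simp: L_def U_def)
        then have "t (e m) < t (e n)" "t (e n) < t (e M)"
          using tn by auto
        then show ?thesis
          using m(2) M(2) unfolding L_def U_def by fastforce
      qed
    qed
  qed simp
  show ?case
    using Suc.prems new IH irr less_antisym by (metis less_SucE)
qed simp

lemma cone_less_iff_points_less:
  assumes G: "group G" and P: "P \<in> LO G" and e: "enumeration G e"
    and t: "realization_points G P e t" and a: "a \<in> carrier G" and b: "b \<in> carrier G"
  shows "cone_less G P a b \<longleftrightarrow> t a < t b"
proof -
  have mono: "t u < t v" if uv: "u \<in> carrier G" "v \<in> carrier G" "cone_less G P u v" for u v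
  proof -
    obtain j k where "u = e j" "v = e k"
      using e uv(1,2) unfolding enumeration_def bij_betw_def by blast
    then show ?thesis
      \<comment> \<open>The bound \<open>Suc (max j k)\<close> is a stage at which both points have
        been placed.\<close>
      using realization_points_strict_mono[OF G P e t, of j "Suc (max j k)" k] uv(3) by simp
  qed
  have "cone_less G P a b \<or> a = b \<or> cone_less G P b a"
    using left_ordering_cone_less[OF G P] a b unfolding left_ordering_def by blast
  then show ?thesis
    using mono[OF a b] mono[OF b a] by auto
qed

section \<open>The normalized realization as an action on the line\<close>

lemma normalized_realization_hom:
  assumes A: "A \<in> hom G Homeo_line"
    and \<phi>: "homeomorphism UNIV UNIV \<phi> \<phi>'" "strict_mono \<phi> \<or> antimono \<phi>"
    and B: "\<And>g. g \<in> carrier G \<Longrightarrow> B g = \<phi> \<circ> A g \<circ> \<phi>'"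
    and G: "group G"
  shows "B \<in> hom G Homeo_line"
proof (rule homI)
  interpret group G by fact
  have inv: "\<phi> (\<phi>' r) = r" "\<phi>' (\<phi> r) = r" for r
    using \<phi>(1) by (auto simp: homeomorphism_def)
  fix g assume g: "g \<in> carrier G"
  obtain A' where A': "homeomorphism UNIV UNIV (A g) A'" and Ag: "strict_mono (A g)"
    using hom_in_carrier[OF A g] by (auto simp: Homeo_line_def)
  have "homeomorphism UNIV UNIV (B g) (\<phi> \<circ> (A' \<circ> \<phi>'))"
    unfolding B[OF g]
    using homeomorphism_compose[OF homeomorphism_compose[OF homeomorphism_symD[OF \<phi>(1)] A'] \<phi>(1)]
    by (simp add: comp_assoc)
  moreover have "strict_mono (B g)"
    using \<phi>(2)
  proof
    assume *: "strict_mono \<phi>"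
    have "strict_mono \<phi>'"
      by (rule strict_monoI) (metis * inv(1) strict_mono_less)
    then show ?thesis
      using * Ag unfolding B[OF g] by (intro strict_mono_o)
  next
    assume *: "antimono \<phi>"
    \<comment> \<open>\<open>antimono\<close> is weak; the inverse makes the reversal strict. The
      reversals by \<open>\<phi>\<close> and \<open>\<phi>'\<close> then cancel, so
      \<open>B g\<close> is increasing.\<close>
    have rev: "\<phi> r < \<phi> s" if "s < r" for r s
      using antimonoD[OF *, of s r] that inv(2) by (metis less_le)
    have rev': "\<phi>' r < \<phi>' s" if "s < r" for r s
      using antimonoD[OF *, of "\<phi>' s" "\<phi>' r"] that inv(1) by (metis not_le)
    show ?thesis
      by (rule strict_monoI) (simp add: B[OF g] rev rev' strict_monoD[OF Ag])
  qed
  ultimately show "B g \<in> carrier Homeo_line"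
    by (auto simp: Homeo_line_def)
  fix h assume h: "h \<in> carrier G"
  show "B (g \<otimes>\<^bsub>G\<^esub> h) = B g \<otimes>\<^bsub>Homeo_line\<^esub> B h"
    using hom_mult[OF A g h] by (simp add: B g h fun_eq_iff inv)
qed

lemma int_pow_acts_by_translation:
  assumes G: "group G" and B: "B \<in> hom G Homeo_line" and x: "x \<in> carrier G"
    and Bx: "B x = (\<lambda>r. r + 1)"
  shows "B (x [^]\<^bsub>G\<^esub> (n::int)) r = r + of_int n"
proof -
  interpret group_hom G Homeo_line B
    using G group_Homeo_line B by (simp add: group_hom_def group_hom_axioms_def)
  have step: "B (x [^]\<^bsub>G\<^esub> (i + 1)) r = B (x [^]\<^bsub>G\<^esub> i) r + 1" for i :: int
  proof -
    \<comment> \<open>Splitting off \<open>x\<close> on the left makes \<open>B x\<close> the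
      outermost map, which adds \<open>1\<close> to the value.\<close>
    have "x [^]\<^bsub>G\<^esub> (1 + i) = x \<otimes>\<^bsub>G\<^esub> x [^]\<^bsub>G\<^esub> i"
      using G.int_pow_mult[OF x, of 1 i] x by simp
    then show ?thesis
      using hom_mult[OF x G.int_pow_closed[OF x], of i] by (simp add: Bx add.commute)
  qed
  show ?thesis
  proof (induction n rule: int_induct[where k = 0])
    case (step2 i)
    then show ?case using step[of "i - 1"] by simp
  qed (use hom_one step in auto)
qed

text \<open>The order of the group is that of the points \<open>t\<close>, and \<open>\<phi>\<close>
  carries these to the orbit of \<open>\<phi> 0\<close> under \<open>B\<close>, reversing them
  exactly when \<open>x\<close> is not positive. The definition of \<open>rho\<close> swaps its
  inequalities in the same case, so both cases become the same condition on the line.\<close>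

lemma rho_eq_floor:
  assumes G: "group G" and P: "P \<in> LO G" and x: "x \<in> carrier G" and h: "h \<in> carrier G"
    and e: "enumeration G e" and A: "dynamical_realization G P e A"
    and B: "B \<in> hom G Homeo_line" and Bx: "B x = (\<lambda>r. r + 1)"
    and \<phi>: "homeomorphism UNIV UNIV \<phi> \<phi>'"
      "if cone_less G P \<one>\<^bsub>G\<^esub> x then strict_mono \<phi> else antimono \<phi>"
    and conj: "\<And>g. g \<in> carrier G \<Longrightarrow> B g = \<phi> \<circ> A g \<circ> \<phi>'"
  shows "rho G x P h = \<lfloor>B h (\<phi> 0) - \<phi> 0\<rfloor>"
proof -
  interpret group G by fact
  obtain t where t: "realization_points G P e t"
    and act: "\<And>g h. g \<in> carrier G \<Longrightarrow> h \<in> carrier G \<Longrightarrow> A g (t h) = t (g \<otimes>\<^bsub>G\<^esub> h)"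
    using A unfolding dynamical_realization_def by blast
  have inv: "\<phi>' (\<phi> r) = r" for r
    using \<phi>(1) by (auto simp: homeomorphism_def)
  have t1: "t \<one>\<^bsub>G\<^esub> = 0"
    using t e by (auto simp: realization_points_def enumeration_def)
  \<comment> \<open>The identity sits at \<open>0\<close>, so the orbit of \<open>\<phi> 0\<close>
    records the positions of all group elements.\<close>
  have pt: "\<phi> (t g) = B g (\<phi> 0)" if "g \<in> carrier G" for g
    using act[OF that one_closed] that by (simp add: conj inv t1)
  have pow: "\<phi> (t (x [^]\<^bsub>G\<^esub> (N::int))) = \<phi> 0 + of_int N" for N
    using pt[of "x [^]\<^bsub>G\<^esub> N"] int_pow_acts_by_translation[OF G B x Bx] x by simp
  have lt: "cone_less G P a b \<longleftrightarrow> t a < t b" if "a \<in> carrier G" "b \<in> carrier G" for a b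
    using cone_less_iff_points_less[OF G P e t that] .
  have le: "cone_le G P a b \<longleftrightarrow> t a \<le> t b" if "a \<in> carrier G" "b \<in> carrier G" for a b
  proof -
    have "cone_less G P a b \<or> a = b \<or> cone_less G P b a"
      using left_ordering_cone_less[OF G P] that unfolding left_ordering_def by blast
    then show ?thesis
      using lt[OF that] lt[OF that(2,1)] by (auto simp: cone_le_def)
  qed
  \<comment> \<open>Both branches of \<open>rho\<close> reduce to this half-open condition: the weak
    inequality is at the end \<open>N\<close> in either case.\<close>
  have floor: "(THE N::int. \<phi> 0 + of_int N \<le> B h (\<phi> 0) \<and> B h (\<phi> 0) < \<phi> 0 + of_int (N + 1))
      = \<lfloor>B h (\<phi> 0) - \<phi> 0\<rfloor>"
    by (rule the_equality) (auto, linarith+)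
  show ?thesis
  proof (cases "cone_less G P \<one>\<^bsub>G\<^esub> x")
    case True
    then have mono: "strict_mono \<phi>" using \<phi>(2) by simp
    have "cone_le G P (x [^]\<^bsub>G\<^esub> N) h \<and> cone_less G P h (x [^]\<^bsub>G\<^esub> (N + 1)) \<longleftrightarrow>
        \<phi> 0 + of_int N \<le> B h (\<phi> 0) \<and> B h (\<phi> 0) < \<phi> 0 + of_int (N + 1)" for N :: int
      unfolding pow[symmetric] pt[OF h, symmetric]
      using x h by (simp add: lt le strict_mono_less_eq[OF mono] strict_mono_less[OF mono])
    then show ?thesis
      using True floor by (simp add: rho_def)
  next
    case False
    then have anti: "antimono \<phi>" using \<phi>(2) by simp
    \<comment> \<open>Injectivity of \<open>\<phi>\<close> turns weak antitonicity into an
      equivalence.\<close>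
    have rev: "\<phi> r \<le> \<phi> s \<longleftrightarrow> s \<le> r" for r s
      using antimonoD[OF anti] inv by (metis linear order_antisym)
    have rev': "\<phi> r < \<phi> s \<longleftrightarrow> s < r" for r s
      using rev[of s r] by auto
    have "cone_less G P (x [^]\<^bsub>G\<^esub> (N + 1)) h \<and> cone_le G P h (x [^]\<^bsub>G\<^esub> N) \<longleftrightarrow>
        \<phi> 0 + of_int N \<le> B h (\<phi> 0) \<and> B h (\<phi> 0) < \<phi> 0 + of_int (N + 1)" for N :: int
      unfolding pow[symmetric] pt[OF h, symmetric]
      using x h by (auto simp: lt le rev rev')
    then show ?thesis
      using False floor by (simp add: rho_def)
  qed
qed

section \<open>Comparison of the two quasimorphisms on \<open>H\<close> and of their classes\<close>

theorem theorem3: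
  fixes G :: "('a, 'b) monoid_scheme"
    and H P :: "'a set"
    and x :: 'a
    and e :: "nat \<Rightarrow> 'a"
    and A B :: "'a \<Rightarrow> real \<Rightarrow> real"
  assumes "group G"
    and "countable (carrier G)"
    and "LO G \<noteq> {}"
    and "subgroup H G"
    and "x \<in> centralizer G H"
    and "P \<in> Cof G H x"
    and "enumeration G e"
    and "dynamical_realization G P e A"
    and "normalized_realization G x P A B"
  shows "psi G H x P \<in> carrier (Hb2 (G\<lparr>carrier := H\<rparr>)) \<and>
    eu (G\<lparr>carrier := H\<rparr>) (circle_action B) \<in> carrier (Hb2 (G\<lparr>carrier := H\<rparr>)) \<and>
    psi G H x P =
      inv\<^bsub>Hb2 (G\<lparr>carrier := H\<rparr>)\<^esub> (eu (G\<lparr>carrier := H\<rparr>) (circle_action B))"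
proof -
  let ?K = "G\<lparr>carrier := H\<rparr>"
  interpret group G by fact
  have HG: "h \<in> carrier G" if "h \<in> H" for h
    using subgroup.mem_carrier[OF assms(4) that] .
  have K: "group ?K"
    using subgroup.subgroup_is_group[OF assms(4,1)] .
  have x: "x \<in> carrier G" and comm: "\<And>h. h \<in> H \<Longrightarrow> x \<otimes>\<^bsub>G\<^esub> h = h \<otimes>\<^bsub>G\<^esub> x"
    using assms(5) by (auto simp: centralizer_def)
  have P: "P \<in> LO G"
    using assms(6) by (simp add: Cof_def)
  obtain \<phi> \<phi>' where \<phi>: "homeomorphism UNIV UNIV \<phi> \<phi>'"
      "if cone_less G P \<one>\<^bsub>G\<^esub> x then strict_mono \<phi> else antimono \<phi>"
    and conj: "\<And>g. g \<in> carrier G \<Longrightarrow> B g = \<phi> \<circ> A g \<circ> \<phi>'" and Bx: "B x = (\<lambda>r. r + 1)"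
    using assms(9) unfolding normalized_realization_def by blast
  have "A \<in> hom G Homeo_line"
    using assms(8) by (simp add: dynamical_realization_def)
  moreover have "strict_mono \<phi> \<or> antimono \<phi>"
    using \<phi>(2) by (simp split: if_splits)
  ultimately have B: "B \<in> hom G Homeo_line"
    by (rule normalized_realization_hom[OF _ \<phi>(1) _ _ assms(1)]) (rule conj)
  \<comment> \<open>Commuting with \<open>x\<close> becomes commuting with the unit translation, so
    \<open>B\<close> sends \<open>H\<close> to lifts of circle maps.\<close>
  have "B h (r + 1) = B h r + 1" if "h \<in> H" for h r
    using hom_mult[OF B HG[OF that] x] hom_mult[OF B x HG[OF that]] comm[OF that]
    by (simp add: Bx fun_eq_iff)
  then have BH: "B \<in> hom ?K Homeo_tilde"
    using hom_in_carrier[OF B HG] hom_mult[OF B HG HG]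
    by (intro homI) (simp_all add: Homeo_tilde_def)
  let ?n = "\<lambda>h. \<lfloor>B h 0\<rfloor>"
  have bd: "\<exists>M. \<forall>p. \<bar>cob1 ?K ?n p\<bar> \<le> M"
    by (rule bounded_cob1_floor[OF K BH])
  then have bd': "\<exists>M. \<forall>p. \<bar>cob1 ?K (\<lambda>h. - ?n h) p\<bar> \<le> M"
    by (simp add: cob1_minus)
  \<comment> \<open>The displacements of \<open>B h\<close> at \<open>0\<close> and at
    \<open>\<phi> 0\<close> differ by less than \<open>1\<close>, so their floors are close; any
    uniform bound would do.\<close>
  have "\<bar>?n h - rho G x P h\<bar> \<le> 2" if "h \<in> H" for h
  proof -
    have "rho G x P h = \<lfloor>B h (\<phi> 0) - \<phi> 0\<rfloor>"
      using rho_eq_floor[OF assms(1) P x HG[OF that] assms(7,8) B Bx \<phi>] conj by blast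
    moreover have "B h \<in> carrier Homeo_tilde"
      using hom_in_carrier[OF BH] that by simp
    ultimately show ?thesis
      using Homeo_tilde_between[of "B h", where s = 0 and r = "\<phi> 0"] by (simp, linarith)
  qed
  then have "psi G H x P = bclass ?K (cob1 ?K ?n)"
    unfolding psi_def by (intro bclass_cong[OF K bd]) auto
  moreover have "eu ?K (circle_action B) = bclass ?K (cob1 ?K (\<lambda>h. - ?n h))"
    by (rule eu_circle_action[OF K BH])
  \<comment> \<open>The inverse is taken of the class of the coboundary of \<open>- ?n\<close>; the
    double negation returns \<open>?n\<close>, whose class is \<open>psi G H x P\<close>.\<close>
  ultimately show ?thesis
    using bclass_cob1_in_Hb2[OF K] inv_Hb2_bclass_cob1[OF K bd'] bd bd' by simp
qed

end
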